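(* Let $D$ and $n$ be positive integers. Let $(G_n^D,\cdot)$ be the group of $D$-permutations of degree $n$, let $\mathcal X$ be the set of all triangular lattices of degree $n$ contained in $\mathbb Z_n^D$, let $\mathcal P=\mathcal P_n^D$ be the principal lattice, and let $\varphi:G_n^D\to\mathcal X$ be the bijection $\varphi(A)=A\mathcal P$. Then the group $(G_n^D,\cdot)$ is isomorphic to $(\mathcal X,* )$, where the binary operation $*$ on $\mathcal X$ is given by $$\mathcal T*\mathcal S:=\varphi\bigl(\varphi^{-1}(\mathcal T)\cdot\varphi^{-1}(\mathcal S)\bigr).$$
   Context: Notation: $\mathbb Z_n=\{0,1,\dots,n\}$ and $\mathbb Z_n^D=(\mathbb Z_n)^D$. Triangular lattice: a subset $\mathcal T\subset\mathbb R^D$ is a triangular lattice of degree $n$ in $D$ dimensions if for each $i=1,\dots,D$ there are $n+1$ distinct real coordinates, numbered $p_{i,0},\dots,p_{i,n}$, such that $\mathcal T=\{(p_{1,k_1},\dots,p_{D,k_D}): k_i\in\mathbb Z_n,\ \sum_{i=1}^D k_i\le n\}$. $\mathcal X$ denotes the set of all triangular lattices of degree $n$ in $D$ dimensions that are subsets of $\mathbb Z_n^D$. Principal lattice: $\mathcal P_n^D=\{(j_1,\dots,j_D)\in\mathbb Z^D: j_k\ge 0,\ \sum_k j_k\le n\}$. $D$-permutation of degree $n$: a map $A=(a_1,\dots,a_D)^T:\mathbb Z_n^D\to\mathbb Z_n^D$, $A\mathbf p=(a_1(p_1),\dots,a_D(p_D))^T$, where each $a_i:\mathbb Z_n\to\mathbb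 Z_n$ is a permutation. $G_n^D$ is the set of all $D$-permutations of degree $n$; it is a group under $A\cdot B=(a_1\circ b_1,\dots,a_D\circ b_D)^T$. For $T\subseteq\mathbb Z_n^D$, $AT=\{A\mathbf p:\mathbf p\in T\}$.
   Formalization: For D = 1 the map φ is not a bijection (𝒳 has one element, G has (n+1)!), so the claim fails there; the isomorphism is stated whenever φ is a bijection, and φ is proved to be a bijection for all D ≥ 2. *)

theory Defs
  imports "HOL-Analysis.Finite_Cartesian_Product" "HOL-Algebra.Group"
begin

text \<open>The dimension \<open>D\<close> is the cardinality of the finite index type \<open>'d\<close>, and everything
  lives in \<open>real ^ 'd\<close>; in particular the numbers \<open>0, \<dots>, n\<close> are taken as reals.\<close>

definition Zn :: "nat \<Rightarrow> real set" where
  "Zn n = real ` {0..n}"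

definition ZnD :: "nat \<Rightarrow> (real ^ 'd::finite) set" where
  "ZnD n = {x. \<forall>i. x $ i \<in> Zn n}"

definition triangular_lattice :: "nat \<Rightarrow> (real ^ 'd::finite) set \<Rightarrow> bool" where
  "triangular_lattice n T \<longleftrightarrow>
    (\<exists>p :: 'd \<Rightarrow> nat \<Rightarrow> real.
       (\<forall>i. inj_on (p i) {0..n}) \<and>
       T = {\<chi> i. p i (k i) | k :: 'd \<Rightarrow> nat.
              (\<forall>i. k i \<in> {0..n}) \<and> (\<Sum>i\<in>UNIV. k i) \<le> n})"

definition triangular_lattices :: "nat \<Rightarrow> (real ^ 'd::finite) set set" where
  "triangular_lattices n = {T. triangular_lattice n T \<and> T \<subseteq> ZnD n}"

definition principal_lattice :: "nat \<Rightarrow> (real ^ 'd::finite) set" where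
  "principal_lattice n =
    {j. (\<forall>k. j $ k \<in> \<int> \<and> j $ k \<ge> 0) \<and> (\<Sum>k\<in>UNIV. j $ k) \<le> real n}"

text \<open>Maps with domain \<open>ZnD n\<close> are represented by extensional functions (\<open>undefined\<close>
  outside \<open>ZnD n\<close>), so that equality of functions is equality of maps on \<open>ZnD n\<close>.\<close>

definition dmap :: "nat \<Rightarrow> ('d \<Rightarrow> real \<Rightarrow> real) \<Rightarrow> real ^ 'd::finite \<Rightarrow> real ^ 'd" where
  "dmap n a = (\<lambda>p \<in> ZnD n. \<chi> i. a i (p $ i))"

definition dperms :: "nat \<Rightarrow> (real ^ 'd::finite \<Rightarrow> real ^ 'd) set" where
  "dperms n = {dmap n a | a. \<forall>i. bij_betw (a i) (Zn n) (Zn n)}"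

text \<open>The product is composition of maps on \<open>ZnD n\<close>; by \<open>dmap_compose\<close> below this is
  the componentwise product \<open>(a\<^sub>1 \<circ> b\<^sub>1, \<dots>, a\<^sub>D \<circ> b\<^sub>D)\<close>.\<close>

definition dperm_group :: "nat \<Rightarrow> (real ^ 'd::finite \<Rightarrow> real ^ 'd) monoid" where
  "dperm_group n =
    \<lparr>carrier = dperms n, mult = compose (ZnD n), one = (\<lambda>p \<in> ZnD n. p)\<rparr>"

lemma dmap_compose:
  assumes "\<And>i. bij_betw (b i) (Zn n) (Zn n)"
  shows "dmap n a \<otimes>\<^bsub>dperm_group n\<^esub> dmap n b = dmap n (\<lambda>i. a i \<circ> b i)"
proof -
  have "(\<chi> i. b i (p $ i)) \<in> ZnD n" if "p \<in> ZnD n" for p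
    using that assms by (auto simp: ZnD_def dest: bij_betwE)
  then show ?thesis
    by (auto simp: dperm_group_def dmap_def compose_def restrict_def fun_eq_iff)
qed

definition lattice_of :: "nat \<Rightarrow> (real ^ 'd::finite \<Rightarrow> real ^ 'd) \<Rightarrow> (real ^ 'd) set" where
  "lattice_of n A = A ` principal_lattice n"

definition lattice_perm :: "nat \<Rightarrow> (real ^ 'd::finite) set \<Rightarrow> (real ^ 'd \<Rightarrow> real ^ 'd)" where
  "lattice_perm n = inv_into (dperms n) (lattice_of n)"

definition lattice_group :: "nat \<Rightarrow> (real ^ 'd::finite) set monoid" where
  "lattice_group n =
    \<lparr>carrier = triangular_lattices n,
     mult = (\<lambda>T S. lattice_of n (lattice_perm n T \<otimes>\<^bsub>dperm_group n\<^esub> lattice_perm n S)),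
     one = lattice_of n \<one>\<^bsub>dperm_group n\<^esub>\<rparr>"

text \<open>The map \<open>lattice_of n\<close> is the bijection from \<open>dperms n\<close> to \<open>triangular_lattices n\<close> only
  in dimension at least 2. In dimension 1 with \<open>n \<ge> 1\<close> the only triangular lattice contained
  in \<open>ZnD n\<close> is \<open>ZnD n\<close> itself, while there are \<open>(n + 1)!\<close> permutations, so \<open>lattice_of n\<close>
  is not injective and the two structures are not isomorphic.\<close>

end

theory Submission
  imports Defs
begin

text \<open>The isomorphism itself is transport of structure: the operation on lattices is defined by
  pulling back along \<open>\<phi>\<close>, so a bijective \<open>\<phi>\<close> is a group isomorphism. The mathematical content is
  that \<open>\<phi>\<close> is bijective in dimension at least 2.

  Both halves of this concern numberings, that is, families \<open>p\<close> of injective maps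
  \<open>p i\<close> from \<open>{0..n}\<close> to the reals. Applying a \<open>D\<close>-permutation \<open>a\<close> to the principal lattice gives the
  triangular lattice numbered by \<open>p i k = a i k\<close> (\<open>lattice_of_dmap\<close>), and a numbering of a
  triangular lattice inside \<open>ZnD n\<close> has all its coordinates in \<open>Zn n\<close>, so by counting each of its
  components is a permutation. This gives surjectivity.

  Injectivity says that a triangular lattice \<open>T\<close> in dimension at least 2 has only one numbering
  (\<open>numbering_unique\<close>). The reason is that the order of the coordinates on axis \<open>i\<close> can be read
  off from \<open>T\<close>: the slice of \<open>T\<close> at the \<open>k\<close>-th coordinate, projected along the axis, shrinks strictly
  as \<open>k\<close> grows. Hence \<open>k\<close> is the rank of its coordinate in the inclusion order of slices, and this
  rank depends on \<open>T\<close> alone.\<close>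

section \<open>Numberings of a triangular lattice\<close>

definition numbered_lattice :: "nat \<Rightarrow> ('d \<Rightarrow> nat \<Rightarrow> real) \<Rightarrow> (real ^ 'd::finite) set" where
  "numbered_lattice n p =
    {\<chi> i. p i (k i) | k. (\<forall>i. k i \<in> {0..n}) \<and> (\<Sum>i\<in>UNIV. k i) \<le> n}"

lemma numbered_lattice_eq_image:
  "numbered_lattice n p =
    (\<lambda>k. \<chi> i. p i (k i)) ` {k. (\<forall>i. k i \<in> {0..n}) \<and> (\<Sum>i\<in>UNIV. k i) \<le> n}"
  by (auto simp: numbered_lattice_def)

lemma triangular_lattice_iff_numbered:
  "triangular_lattice n T \<longleftrightarrow> (\<exists>p. (\<forall>i. inj_on (p i) {0..n}) \<and> T = numbered_lattice n p)"
  by (simp add: triangular_lattice_def numbered_lattice_def)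

lemma numbered_latticeI:
  assumes "(\<Sum>i\<in>UNIV. k i) \<le> n"
  shows "(\<chi> i. p i (k i)) \<in> numbered_lattice n p"
proof -
  have "k i \<le> n" for i
    using member_le_sum[of i UNIV k] assms by simp
  then show ?thesis
    using assms by (auto simp: numbered_lattice_def)
qed

lemma mem_numbered_lattice_iff:
  assumes inj: "\<And>i. inj_on (p i) {0..n}" and k: "\<And>i. k i \<le> n"
  shows "(\<chi> i. p i (k i)) \<in> numbered_lattice n p \<longleftrightarrow> (\<Sum>i\<in>UNIV. k i) \<le> n"
proof
  assume "(\<chi> i. p i (k i)) \<in> numbered_lattice n p"
  then obtain l where l: "\<forall>i. l i \<in> {0..n}" "(\<Sum>i\<in>UNIV. l i) \<le> n"
    and eq: "(\<chi> i. p i (k i)) = (\<chi> i. p i (l i))"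
    by (auto simp: numbered_lattice_def)
  have "k i = l i" for i
    using eq inj_onD[OF inj, of i "k i" "l i"] k l by (simp add: vec_eq_iff)
  then show "(\<Sum>i\<in>UNIV. k i) \<le> n" using l by simp
qed (rule numbered_latticeI)

lemma coords_numbered_lattice:
  "(\<lambda>x. x $ i) ` numbered_lattice n p = p i ` {0..n}"
proof
  show "(\<lambda>x. x $ i) ` numbered_lattice n p \<subseteq> p i ` {0..n}"
    by (auto simp: numbered_lattice_def)
  show "p i ` {0..n} \<subseteq> (\<lambda>x. x $ i) ` numbered_lattice n p"
  proof (rule image_subsetI)
    fix m assume "m \<in> {0..n}"
    define k where "k = (\<lambda>j. if j = i then m else 0)"
    have "(\<chi> j. p j (k j)) \<in> numbered_lattice n p"
      using \<open>m \<in> {0..n}\<close> by (intro numbered_latticeI) (simp add: k_def)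
    moreover have "p i m = (\<chi> j. p j (k j)) $ i" by (simp add: k_def)
    ultimately show "p i m \<in> (\<lambda>x. x $ i) ` numbered_lattice n p" by blast
  qed
qed

section \<open>Uniqueness of the numbering\<close>

text \<open>Inclusion between the slices of \<open>T\<close> perpendicular to axis \<open>i\<close>, after projection along this
  axis. It mentions only the set \<open>T\<close>, so all numberings of \<open>T\<close> must agree on it.\<close>

definition slice_le :: "(real ^ 'd::finite) set \<Rightarrow> 'd \<Rightarrow> real \<Rightarrow> real \<Rightarrow> bool" where
  "slice_le T i v w \<longleftrightarrow> (\<forall>x\<in>T. x $ i = w \<longrightarrow> (\<chi> j. if j = i then v else x $ j) \<in> T)"

text \<open>Lowering one index keeps the index sum at most \<open>n\<close>. Conversely, a second axis makes it possible
  to find a point of the slice at \<open>b\<close> with index sum exactly \<open>n\<close>, and raising \<open>b\<close> takes this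
  point out of the lattice. In dimension 1 every slice is a single point and the order is lost.\<close>

lemma slice_le_numbered_lattice:
  fixes p :: "'d::finite \<Rightarrow> nat \<Rightarrow> real"
  assumes D: "CARD('d) \<ge> 2" and inj: "\<And>i. inj_on (p i) {0..n}"
    and ab: "a \<le> n" "b \<le> n"
  shows "slice_le (numbered_lattice n p) i (p i a) (p i b) \<longleftrightarrow> a \<le> b"
proof
  have replace: "(\<chi> j. if j = i then p i a else (\<chi> j. p j (k j)) $ j) = (\<chi> j. p j ((k(i := a)) j))"
    for k by (simp add: vec_eq_iff)
  have sum_upd: "(\<Sum>j\<in>UNIV. (k(i := a)) j) + k i = (\<Sum>j\<in>UNIV. k j) + a" for k :: "'d \<Rightarrow> nat"
  proof -
    have "(\<Sum>j\<in>UNIV. (k(i := a)) j) = a + (\<Sum>j\<in>UNIV - {i}. (k(i := a)) j)"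
      by (subst sum.remove[of _ i]) auto
    also have "(\<Sum>j\<in>UNIV - {i}. (k(i := a)) j) = (\<Sum>j\<in>UNIV - {i}. k j)"
      by (rule sum.cong) auto
    finally show ?thesis by (simp add: sum.remove[of UNIV i k])
  qed
  {
    assume le: "a \<le> b"
    show "slice_le (numbered_lattice n p) i (p i a) (p i b)"
      unfolding slice_le_def
    proof (intro ballI impI)
      fix x assume "x \<in> numbered_lattice n p" and xi: "x $ i = p i b"
      then obtain k where k: "\<forall>i. k i \<in> {0..n}" "(\<Sum>i\<in>UNIV. k i) \<le> n"
        and x: "x = (\<chi> i. p i (k i))"
        by (auto simp: numbered_lattice_def)
      have "k i = b"
        using inj_onD[OF inj, of i "k i" b] xi x k ab by simp
      then have "(\<Sum>j\<in>UNIV. (k(i := a)) j) \<le> n"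
        using sum_upd[of k] k le by linarith
      then show "(\<chi> j. if j = i then p i a else x $ j) \<in> numbered_lattice n p"
        unfolding x replace by (rule numbered_latticeI)
    qed
  next
    assume le: "slice_le (numbered_lattice n p) i (p i a) (p i b)"
    have "\<exists>j. j \<noteq> i"
    proof (rule ccontr)
      assume "\<nexists>j. j \<noteq> i"
      then have "(UNIV :: 'd set) = {i}" by auto
      then have "CARD('d) = card {i}" by (rule arg_cong)
      with D show False by simp
    qed
    then obtain j where j: "j \<noteq> i" by blast
    \<comment> \<open>The extremal point of the slice at \<open>b\<close>: axis \<open>j\<close> takes up the rest of the index sum.\<close>
    define k where "k = (\<lambda>l. if l = i then b else if l = j then n - b else 0)"
    have "(\<Sum>l\<in>UNIV. k l) = b + (\<Sum>l\<in>UNIV - {i}. k l)"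
      by (subst sum.remove[of _ i]) (auto simp: k_def)
    also have "(\<Sum>l\<in>UNIV - {i}. k l) = (\<Sum>l\<in>UNIV - {i}. if l = j then n - b else 0)"
      by (rule sum.cong) (auto simp: k_def)
    also have "\<dots> = n - b" using j by simp
    finally have sum_k: "(\<Sum>l\<in>UNIV. k l) = n" using ab by simp
    have "(\<chi> l. p l (k l)) \<in> numbered_lattice n p"
      using sum_k by (intro numbered_latticeI) simp
    moreover have "(\<chi> l. p l (k l)) $ i = p i b" by (simp add: k_def)
    ultimately have "(\<chi> l. p l ((k(i := a)) l)) \<in> numbered_lattice n p"
      using le unfolding slice_le_def replace[symmetric] by blast
    moreover have "(k(i := a)) l \<le> n" for l using ab by (simp add: k_def)
    ultimately have "(\<Sum>l\<in>UNIV. (k(i := a)) l) \<le> n"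
      by (rule mem_numbered_lattice_iff[OF inj, THEN iffD1, rotated])
    moreover have "k i = b" by (simp add: k_def)
    ultimately show "a \<le> b" using sum_upd[of k] sum_k by linarith
  }
qed

text \<open>By the previous lemma the coordinates below the one numbered \<open>k\<close> are those numbered
  \<open>0, \<dots>, k\<close>. Counting them recovers \<open>k\<close> from \<open>T\<close> and the coordinate alone, which is what
  compares two numberings.\<close>

lemma index_eq_slice_rank:
  fixes p :: "'d::finite \<Rightarrow> nat \<Rightarrow> real"
  assumes D: "CARD('d) \<ge> 2" and inj: "\<And>i. inj_on (p i) {0..n}" and k: "k \<le> n"
    and T: "T = numbered_lattice n p"
  shows "card {v \<in> (\<lambda>x. x $ i) ` T. slice_le T i v (p i k)} = Suc k"
proof -
  have "slice_le T i (p i l) (p i k) \<longleftrightarrow> l \<le> k" if "l \<le> n" for l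
    unfolding T by (rule slice_le_numbered_lattice[OF D inj that k])
  then have "{v \<in> p i ` {0..n}. slice_le T i v (p i k)} = p i ` {0..k}"
    using k by auto
  then have "{v \<in> (\<lambda>x. x $ i) ` T. slice_le T i v (p i k)} = p i ` {0..k}"
    unfolding T coords_numbered_lattice .
  moreover have "inj_on (p i) {0..k}"
    using inj by (rule inj_on_subset) (use k in auto)
  ultimately show ?thesis by (simp add: card_image)
qed

lemma numbering_unique:
  fixes p q :: "'d::finite \<Rightarrow> nat \<Rightarrow> real"
  assumes D: "CARD('d) \<ge> 2"
    and p: "\<And>i. inj_on (p i) {0..n}" and q: "\<And>i. inj_on (q i) {0..n}"
    and eq: "numbered_lattice n p = numbered_lattice n q" and k: "k \<le> n"
  shows "p i k = q i k"
proof -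
  have "p i k \<in> q i ` {0..n}"
    using k coords_numbered_lattice[of i n p] coords_numbered_lattice[of i n q] eq by force
  then obtain m where m: "m \<le> n" "p i k = q i m" by auto
  have "Suc k = Suc m"
    using index_eq_slice_rank[of p n k _ i, OF D p k refl]
      index_eq_slice_rank[of q n m _ i, OF D q m(1) refl] eq m(2) by metis
  with m show ?thesis by simp
qed

section \<open>Lattices and permutations\<close>

lemma principal_lattice_eq_numbered:
  "principal_lattice n = numbered_lattice n (\<lambda>_. real)"
proof
  show "principal_lattice n \<subseteq> (numbered_lattice n (\<lambda>_. real) :: (real ^ 'd::finite) set)"
  proof
    fix x :: "real ^ 'd" assume x: "x \<in> principal_lattice n"
    define k where "k = (\<lambda>i. nat \<lfloor>x $ i\<rfloor>)"
    have xk: "x $ i = real (k i)" for i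
      using x by (auto simp: principal_lattice_def k_def elim!: Ints_cases dest!: spec[of _ i])
    then have "real (\<Sum>i\<in>UNIV. k i) \<le> real n"
      using x by (simp add: principal_lattice_def)
    then have "(\<chi> i. real (k i)) \<in> numbered_lattice n (\<lambda>_. real)"
      by (intro numbered_latticeI) (simp only: of_nat_le_iff)
    moreover have "x = (\<chi> i. real (k i))" using xk by (simp add: vec_eq_iff)
    ultimately show "x \<in> numbered_lattice n (\<lambda>_. real)" by simp
  qed
  show "numbered_lattice n (\<lambda>_. real) \<subseteq> (principal_lattice n :: (real ^ 'd::finite) set)"
    by (auto simp: numbered_lattice_def principal_lattice_def simp flip: of_nat_sum)
qed

lemma lattice_of_dmap:
  "lattice_of n (dmap n a) = numbered_lattice n (\<lambda>i k. a i (real k))"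
proof -
  have "dmap n a (\<chi> i. real (k i)) = (\<chi> i. a i (real (k i)))" if "\<forall>i. k i \<in> {0..n}" for k
    using that by (simp add: dmap_def ZnD_def Zn_def)
  then show ?thesis
    unfolding lattice_of_def principal_lattice_eq_numbered numbered_lattice_eq_image image_image
    by (intro image_cong) auto
qed

lemma bij_betw_numbering_Zn:
  assumes "bij_betw f (Zn n) (Zn n)"
  shows "bij_betw (\<lambda>k. f (real k)) {0..n} (Zn n)"
proof -
  have "bij_betw real {0..n} (Zn n)"
    by (simp add: Zn_def bij_betw_def inj_on_def)
  from bij_betw_trans[OF this assms] show ?thesis by (simp add: comp_def)
qed

lemma lattice_of_dmap_mem:
  assumes "\<And>i. bij_betw (a i) (Zn n) (Zn n)"
  shows "lattice_of n (dmap n a) \<in> triangular_lattices n"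
proof -
  have bij: "bij_betw (\<lambda>k. a i (real k)) {0..n} (Zn n)" for i
    by (rule bij_betw_numbering_Zn) (rule assms)
  then have "triangular_lattice n (lattice_of n (dmap n a))"
    unfolding triangular_lattice_iff_numbered lattice_of_dmap by (metis bij_betw_def)
  moreover have "lattice_of n (dmap n a) \<subseteq> ZnD n"
    using bij_betwE[OF bij] unfolding lattice_of_dmap
    by (auto simp: numbered_lattice_def ZnD_def)
  ultimately show ?thesis by (simp add: triangular_lattices_def)
qed

text \<open>Both \<open>{0..n}\<close> and \<open>Zn n\<close> have \<open>n + 1\<close> elements, so a numbering with values in \<open>Zn n\<close> is
  automatically onto.\<close>

lemma triangular_lattice_eq_lattice_of:
  fixes T :: "(real ^ 'd::finite) set"
  assumes "T \<in> triangular_lattices n"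
  shows "\<exists>A\<in>dperms n. T = lattice_of n A"
proof -
  obtain p where inj: "\<And>i. inj_on (p i) {0..n}" and T: "T = numbered_lattice n p" "T \<subseteq> ZnD n"
    using assms by (auto simp: triangular_lattices_def triangular_lattice_iff_numbered)
  define a where "a = (\<lambda>i (x :: real). p i (nat \<lfloor>x\<rfloor>))"
  have "bij_betw (a i) (Zn n) (Zn n)" for i
  proof -
    have "p i ` {0..n} \<subseteq> Zn n"
      unfolding coords_numbered_lattice[symmetric] using T by (auto simp: ZnD_def)
    moreover have "a i ` Zn n = p i ` {0..n}"
      by (simp add: Zn_def a_def image_image)
    moreover have "inj_on (a i) (Zn n)"
      using inj[of i] by (auto simp: inj_on_def Zn_def a_def)
    ultimately show ?thesis
      by (metis Zn_def bij_betw_def endo_inj_surj finite_atLeastAtMost finite_imageI)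
  qed
  then have "dmap n a \<in> dperms n" by (auto simp: dperms_def)
  moreover have "lattice_of n (dmap n a) = T"
    unfolding lattice_of_dmap T a_def by simp
  ultimately show ?thesis by blast
qed

lemma dmap_cong:
  assumes "\<And>i k. k \<le> n \<Longrightarrow> a i (real k) = b i (real k)"
  shows "dmap n a = dmap n b"
proof -
  have "a i x = b i x" if "x \<in> Zn n" for i x
    using assms that by (auto simp: Zn_def)
  then show ?thesis
    unfolding dmap_def by (intro restrict_ext) (simp add: ZnD_def vec_eq_iff)
qed

lemma bij_betw_lattice_of:
  assumes D: "CARD('d::finite) \<ge> 2"
  shows "bij_betw (lattice_of n) (dperms n :: (real ^ 'd \<Rightarrow> real ^ 'd) set) (triangular_lattices n)"
  unfolding bij_betw_def
proof
  show "inj_on (lattice_of n) (dperms n :: (real ^ 'd \<Rightarrow> real ^ 'd) set)"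
  proof (rule inj_onI)
    fix A B :: "real ^ 'd \<Rightarrow> real ^ 'd"
    assume "A \<in> dperms n" "B \<in> dperms n" and eq: "lattice_of n A = lattice_of n B"
    then obtain a b where A: "A = dmap n a" "\<And>i. bij_betw (a i) (Zn n) (Zn n)"
      and B: "B = dmap n b" "\<And>i. bij_betw (b i) (Zn n) (Zn n)"
      by (auto simp: dperms_def)
    have inj: "inj_on (\<lambda>k. a i (real k)) {0..n}" "inj_on (\<lambda>k. b i (real k)) {0..n}" for i
      using bij_betw_numbering_Zn[OF A(2)[of i]] bij_betw_numbering_Zn[OF B(2)[of i]]
      by (simp_all add: bij_betw_def)
    have "a i (real k) = b i (real k)" if "k \<le> n" for i k
      using numbering_unique[of "\<lambda>i k. a i (real k)" n "\<lambda>i k. b i (real k)", OF D inj _ that] eq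
      unfolding A(1) B(1) lattice_of_dmap by simp
    then show "A = B" unfolding A(1) B(1) by (rule dmap_cong)
  qed
  show "lattice_of n ` dperms n = (triangular_lattices n :: (real ^ 'd) set set)"
    using triangular_lattice_eq_lattice_of lattice_of_dmap_mem
    by (fastforce simp: dperms_def)
qed

section \<open>The groups\<close>

lemma one_dperm_group: "\<one>\<^bsub>dperm_group n\<^esub> = dmap n (\<lambda>_ x. x)"
  by (simp add: dperm_group_def dmap_def)

lemma group_dperm_group:
  "group (dperm_group n :: (real ^ 'd::finite \<Rightarrow> real ^ 'd) monoid)" (is "group ?G")
proof -
  have carrier: "carrier ?G = {dmap n a | a. \<forall>i. bij_betw (a i) (Zn n) (Zn n)}"
    by (simp add: dperm_group_def dperms_def)
  have maps: "A \<in> ZnD n \<rightarrow> ZnD n" if "A \<in> carrier ?G" for A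
    using that by (fastforce simp: carrier dmap_def ZnD_def dest: bij_betwE)
  show ?thesis
  proof (rule groupI)
    fix A B assume "A \<in> carrier ?G" "B \<in> carrier ?G"
    then obtain a b where "A = dmap n a" "B = dmap n b"
      and "\<And>i. bij_betw (a i) (Zn n) (Zn n)" and "\<And>i. bij_betw (b i) (Zn n) (Zn n)"
      by (auto simp: carrier)
    then have "A \<otimes>\<^bsub>?G\<^esub> B = dmap n (\<lambda>i. a i \<circ> b i)"
      and "\<And>i. bij_betw (a i \<circ> b i) (Zn n) (Zn n)"
      by (auto simp: dmap_compose intro: bij_betw_trans)
    then show "A \<otimes>\<^bsub>?G\<^esub> B \<in> carrier ?G"
      unfolding carrier by blast
  next
    show "\<one>\<^bsub>?G\<^esub> \<in> carrier ?G"
      unfolding one_dperm_group carrier using bij_betw_id[of "Zn n"] by (auto simp: id_def)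
  next
    fix A B C assume "A \<in> carrier ?G" "B \<in> carrier ?G" "C \<in> carrier ?G"
    then show "A \<otimes>\<^bsub>?G\<^esub> B \<otimes>\<^bsub>?G\<^esub> C = A \<otimes>\<^bsub>?G\<^esub> (B \<otimes>\<^bsub>?G\<^esub> C)"
      using compose_assoc[OF maps[of C], of A B] by (simp add: dperm_group_def)
  next
    fix A assume "A \<in> carrier ?G"
    then obtain a where a: "A = dmap n a" "\<And>i. bij_betw (a i) (Zn n) (Zn n)"
      by (auto simp: carrier)
    then show "\<one>\<^bsub>?G\<^esub> \<otimes>\<^bsub>?G\<^esub> A = A"
      unfolding one_dperm_group by (simp add: dmap_compose comp_def)
    define b where "b = (\<lambda>i. inv_into (Zn n) (a i))"
    have "dmap n (\<lambda>i. b i \<circ> a i) = dmap n (\<lambda>_ x. x)"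
      using a(2) by (intro dmap_cong) (auto simp: b_def Zn_def bij_betw_def inv_into_f_f)
    then have "dmap n b \<otimes>\<^bsub>?G\<^esub> A = \<one>\<^bsub>?G\<^esub>"
      unfolding one_dperm_group a(1) using a(2) by (simp add: dmap_compose)
    moreover have "dmap n b \<in> carrier ?G"
      using a(2) by (auto simp: carrier b_def intro: bij_betw_inv_into)
    ultimately show "\<exists>B\<in>carrier ?G. B \<otimes>\<^bsub>?G\<^esub> A = \<one>\<^bsub>?G\<^esub>" by blast
  qed
qed

lemma lattice_of_iso:
  assumes bij: "bij_betw (lattice_of n) (dperms n :: (real ^ 'd::finite \<Rightarrow> real ^ 'd) set)
    (triangular_lattices n)"
  shows "lattice_of n \<in> iso (dperm_group n :: (real ^ 'd \<Rightarrow> real ^ 'd) monoid) (lattice_group n)"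
proof -
  have "lattice_perm n (lattice_of n A) = A" if "A \<in> dperms n" for A :: "real ^ 'd \<Rightarrow> real ^ 'd"
    using bij that by (simp add: lattice_perm_def bij_betw_def)
  then show ?thesis
    using bij by (auto simp: iso_def hom_def lattice_group_def dperm_group_def dest: bij_betwE)
qed

theorem theorem3p24:
  fixes n :: nat
  assumes "n \<ge> 1"
  shows "group (dperm_group n :: (real ^ 'd::finite \<Rightarrow> real ^ 'd) monoid) \<and>
    (CARD('d) \<ge> 2 \<longrightarrow>
      bij_betw (lattice_of n) (dperms n :: (real ^ 'd \<Rightarrow> real ^ 'd) set) (triangular_lattices n)) \<and>
    (bij_betw (lattice_of n) (dperms n :: (real ^ 'd \<Rightarrow> real ^ 'd) set) (triangular_lattices n) \<longrightarrow>
      group (lattice_group n :: (real ^ 'd) set monoid) \<and>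
      (dperm_group n :: (real ^ 'd \<Rightarrow> real ^ 'd) monoid) \<cong> (lattice_group n :: (real ^ 'd) set monoid))"
proof (intro conjI impI)
  show G: "group (dperm_group n :: (real ^ 'd \<Rightarrow> real ^ 'd) monoid)"
    by (rule group_dperm_group)
  show "bij_betw (lattice_of n) (dperms n :: (real ^ 'd \<Rightarrow> real ^ 'd) set) (triangular_lattices n)"
    if "CARD('d) \<ge> 2"
    using that by (rule bij_betw_lattice_of)
  assume "bij_betw (lattice_of n) (dperms n :: (real ^ 'd \<Rightarrow> real ^ 'd) set) (triangular_lattices n)"
  then have iso: "lattice_of n \<in>
      iso (dperm_group n :: (real ^ 'd \<Rightarrow> real ^ 'd) monoid) (lattice_group n)"
    by (rule lattice_of_iso)
  then show "(dperm_group n :: (real ^ 'd \<Rightarrow> real ^ 'd) monoid) \<cong> (lattice_group n :: (real ^ 'd) set monoid)"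
    by (rule is_isoI)
  \<comment> \<open>The neutral element of \<open>lattice_group n\<close> is by definition the image of the neutral element,
    so replacing it by that image changes nothing.\<close>
  show "group (lattice_group n :: (real ^ 'd) set monoid)"
    using group.iso_imp_img_group[OF G iso] by (simp add: lattice_group_def)
qed

end
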